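(* For every integer $n\geq2$, $$p(n)=n\cdot\nu(n)-\sum_{k=3}^{n}(k-1)\gamma(k),$$ where the sum is empty (equal to $0$) if $n=2$.
   Context: $p(n)$ is the number of integer partitions of $n$. A nuclear partition is an integer partition with no part equal to $1$, and $\nu(n)$ is the number of nuclear partitions of $n$. $\gamma(n)$ denotes the number of nuclear partitions $\mu=(\mu_1,\mu_2,\dots,\mu_r)$ of $n$, with $\mu_1\geq\mu_2\geq\dots\geq\mu_r\geq2$ and $r\geq2$, such that $\mu_1=\mu_2$ (so the two largest parts are equal). *)

theory Defs
  imports Main
begin

text \<open>
  An integer partition of \<open>n\<close> is the weakly decreasing list of its (positive) parts;
  the empty list is the only partition of 0.
\<close>

definition partitions :: "nat \<Rightarrow> nat list set" where
  "partitions n = {\<mu>. sorted_wrt (\<ge>) \<mu> \<and> (\<forall>x\<in>set \<mu>. 1 \<le> x) \<and> sum_list \<mu> = n}"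

definition nuclear_partitions :: "nat \<Rightarrow> nat list set" where
  "nuclear_partitions n = {\<mu> \<in> partitions n. 1 \<notin> set \<mu>}"

definition num_partitions :: "nat \<Rightarrow> nat" where
  "num_partitions n = card (partitions n)"

definition nu :: "nat \<Rightarrow> nat" where
  "nu n = card (nuclear_partitions n)"

definition gamma :: "nat \<Rightarrow> nat" where
  "gamma n = card {\<mu> \<in> nuclear_partitions n. 2 \<le> length \<mu> \<and> \<mu> ! 0 = \<mu> ! 1}"

lemma finite_partitions: "finite (partitions n)"
proof (rule finite_subset)
  show "partitions n \<subseteq> {xs. set xs \<subseteq> {..n} \<and> length xs \<le> n}"
  proof
    fix xs assume "xs \<in> partitions n"
    then have pos: "\<forall>x\<in>set xs. 1 \<le> x" and s: "sum_list xs = n"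
      by (auto simp: partitions_def)
    have "length xs \<le> sum_list xs" using pos by (induction xs) auto
    then show "xs \<in> {xs. set xs \<subseteq> {..n} \<and> length xs \<le> n}"
      using s member_le_sum_list by fastforce
  qed
  show "finite {xs. set xs \<subseteq> {..n} \<and> length xs \<le> n}"
    by (rule finite_lists_length_le) simp
qed

end

(* Appending a part 1 gives p(n+1) = p(n) + nu(n+1). For n >= 2, enlarging the largest part by 1
   maps the nuclear partitions of n bijectively onto those of n+1 whose largest part is not
   repeated, so nu(n+1) = nu(n) + gamma(n+1). The formula follows by induction on n. *)
theory Submission
  imports Defs
begin

text \<open>A part 1 is a smallest part, so in a weakly decreasing list it can be taken from the
  very end.\<close>

lemma partitions_Suc:
  "partitions (Suc n) = nuclear_partitions (Suc n) \<union> (\<lambda>xs. xs @ [1]) ` partitions n"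
proof (intro equalityI subsetI)
  fix xs assume xs: "xs \<in> partitions (Suc n)"
  show "xs \<in> nuclear_partitions (Suc n) \<union> (\<lambda>xs. xs @ [1]) ` partitions n"
  proof (cases "1 \<in> set xs")
    case False
    then show ?thesis using xs by (simp add: nuclear_partitions_def)
  next
    case True
    then obtain ys y where ys: "xs = ys @ [y]" by (cases xs rule: rev_cases) auto
    \<comment> \<open>The last part is at most every other part, hence at most 1, and parts are
      positive.\<close>
    have "y = 1" using xs True by (force simp: ys partitions_def sorted_wrt_append)
    then have "ys \<in> partitions n" using xs by (simp add: ys partitions_def sorted_wrt_append)
    then show ?thesis using ys \<open>y = 1\<close> by blast
  qed
qed (auto simp: partitions_def nuclear_partitions_def sorted_wrt_append)

lemma finite_nuclear_partitions: "finite (nuclear_partitions n)"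
  by (rule finite_subset[OF _ finite_partitions[of n]]) (auto simp: nuclear_partitions_def)

lemma num_partitions_Suc: "num_partitions (Suc n) = nu (Suc n) + num_partitions n"
proof -
  have "card ((\<lambda>xs. xs @ [1]) ` partitions n) = num_partitions n"
    unfolding num_partitions_def by (intro card_image inj_onI) simp
  moreover have "nuclear_partitions (Suc n) \<inter> (\<lambda>xs. xs @ [1]) ` partitions n = {}"
    by (auto simp: nuclear_partitions_def)
  ultimately show ?thesis
    unfolding num_partitions_def[of "Suc n"] nu_def partitions_Suc
    by (simp add: card_Un_disjoint finite_nuclear_partitions finite_partitions)
qed

text \<open>Peels off the largest part. The condition \<open>x \<le> n\<close> guards the truncated
  subtraction: without it \<open>[x]\<close> would be accepted for every n < x.\<close>

lemma Cons_in_nuclear_partitions_iff: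
  "x # xs \<in> nuclear_partitions n \<longleftrightarrow>
     2 \<le> x \<and> (\<forall>y\<in>set xs. y \<le> x) \<and> x \<le> n \<and> xs \<in> nuclear_partitions (n - x)"
  by (auto simp: nuclear_partitions_def partitions_def)

lemma Nil_in_nuclear_partitions_iff: "[] \<in> nuclear_partitions n \<longleftrightarrow> n = 0"
  by (auto simp: nuclear_partitions_def partitions_def)

text \<open>The inverse of the map lowers the largest part by 1, which preserves the order exactly
  when that part is not repeated. For the one-part partition, \<open>2 \<le> n\<close> ensures that
  the lowered part n is still at least 2.\<close>

lemma nuclear_partitions_Suc:
  assumes "2 \<le> n"
  shows "nuclear_partitions (Suc n) =
    {\<mu> \<in> nuclear_partitions (Suc n). 2 \<le> length \<mu> \<and> \<mu> ! 0 = \<mu> ! 1} \<union>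
    (\<lambda>xs. Suc (hd xs) # tl xs) ` nuclear_partitions n" (is "_ = ?G \<union> ?f ` _")
proof (intro equalityI subsetI)
  fix \<mu> assume \<mu>: "\<mu> \<in> nuclear_partitions (Suc n)"
  show "\<mu> \<in> ?G \<union> ?f ` nuclear_partitions n"
  proof (cases "\<mu> \<in> ?G")
    case False
    obtain x xs where x: "\<mu> = x # xs"
      using \<mu> by (cases \<mu>) (auto simp: Nil_in_nuclear_partitions_iff)
    have "(x - 1) # xs \<in> nuclear_partitions n"
    proof (cases xs)
      case Nil
      then show ?thesis
        using \<mu> assms by (auto simp: x Cons_in_nuclear_partitions_iff Nil_in_nuclear_partitions_iff)
    next
      case (Cons y ys)
      \<comment> \<open>Outside \<open>?G\<close> the first two parts differ, so x - 1 still bounds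
        y and is at least 2.\<close>
      then have "y < x" "2 \<le> y" "\<forall>z\<in>set ys. z \<le> y"
        using \<mu> False by (auto simp: x Cons_in_nuclear_partitions_iff)
      moreover have "n - (x - 1) = Suc n - x" using calculation by simp
      ultimately show ?thesis
        using \<mu> Cons by (fastforce simp: x Cons_in_nuclear_partitions_iff)
    qed
    moreover have "\<mu> = ?f ((x - 1) # xs)"
      using \<mu> by (simp add: x Cons_in_nuclear_partitions_iff)
    ultimately show ?thesis by blast
  qed simp
next
  fix \<mu> assume "\<mu> \<in> ?G \<union> ?f ` nuclear_partitions n"
  then show "\<mu> \<in> nuclear_partitions (Suc n)"
  proof
    assume "\<mu> \<in> ?f ` nuclear_partitions n"
    then obtain xs where xs: "xs \<in> nuclear_partitions n" "\<mu> = ?f xs" by blast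
    then show ?thesis using assms
      by (cases xs) (auto simp: Cons_in_nuclear_partitions_iff Nil_in_nuclear_partitions_iff le_SucI)
  qed simp
qed

lemma nu_Suc:
  assumes "2 \<le> n"
  shows "nu (Suc n) = gamma (Suc n) + nu n"
proof -
  let ?f = "\<lambda>xs. Suc (hd xs) # tl xs"
  let ?G = "{\<mu> \<in> nuclear_partitions (Suc n). 2 \<le> length \<mu> \<and> \<mu> ! 0 = \<mu> ! 1}"
  \<comment> \<open>Excludes the empty list, where \<open>hd\<close> is unspecified; a nonempty list
    is determined by its head and tail, whence injectivity.\<close>
  have ne: "xs \<noteq> []" if "xs \<in> nuclear_partitions n" for xs
    using that assms by (auto simp: Nil_in_nuclear_partitions_iff)
  have "inj_on ?f (nuclear_partitions n)"
    using ne by (intro inj_onI) (metis list.expand list.inject nat.inject)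
  then have "card (?f ` nuclear_partitions n) = nu n"
    unfolding nu_def by (rule card_image)
  \<comment> \<open>The raised head strictly exceeds the second part, if there is one.\<close>
  moreover have "?f xs \<notin> ?G" if xs: "xs \<in> nuclear_partitions n" for xs
  proof -
    obtain y ys where "xs = y # ys" using ne[OF xs] by (cases xs) auto
    then show ?thesis
      using xs by (cases ys) (auto simp: Cons_in_nuclear_partitions_iff)
  qed
  then have "?G \<inter> ?f ` nuclear_partitions n = {}" by blast
  ultimately have "card (?G \<union> ?f ` nuclear_partitions n) = gamma (Suc n) + nu n"
    unfolding gamma_def by (subst card_Un_disjoint) (auto simp: finite_nuclear_partitions)
  then show ?thesis
    unfolding nu_def[of "Suc n"]
    \<comment> \<open>The equation has its own left-hand side inside \<open>?G\<close>, so it is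
      applied just once, under \<open>card\<close>.\<close>
    by (rule trans[OF arg_cong[OF nuclear_partitions_Suc[OF assms], of card]])
qed

lemma num_partitions_2: "num_partitions 2 = 2"
  and nu_2: "nu 2 = 1"
proof -
  have "partitions 0 = {[]}"
  proof (intro equalityI subsetI)
    fix xs :: "nat list" assume "xs \<in> partitions 0"
    then show "xs \<in> {[]}" by (cases xs) (auto simp: partitions_def)
  qed (simp add: partitions_def)
  then have p0: "num_partitions 0 = 1" by (simp add: num_partitions_def)
  have nuc0: "xs \<in> nuclear_partitions 0 \<longleftrightarrow> xs = []" for xs
    by (cases xs) (simp_all add: Cons_in_nuclear_partitions_iff Nil_in_nuclear_partitions_iff)
  have "xs \<notin> nuclear_partitions 1" for xs
    by (cases xs) (auto simp: Cons_in_nuclear_partitions_iff Nil_in_nuclear_partitions_iff)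
  then have "nuclear_partitions 1 = {}" by blast
  then have nu1: "nu 1 = 0" by (simp add: nu_def)
  have "xs \<in> nuclear_partitions 2 \<longleftrightarrow> xs = [2]" for xs
    by (cases xs) (auto simp: Cons_in_nuclear_partitions_iff Nil_in_nuclear_partitions_iff nuc0)
  then have "nuclear_partitions 2 = {[2]}" by blast
  then show "nu 2 = 1" by (simp add: nu_def)
  moreover have "num_partitions 1 = 1"
    using num_partitions_Suc[of 0] nu1 p0 by simp
  ultimately show "num_partitions 2 = 2"
    using num_partitions_Suc[of 1, unfolded Suc_1] by simp
qed

theorem mainTheorem9:
  fixes n :: nat
  assumes "n \<ge> 2"
  shows "int (num_partitions n) = int n * int (nu n) - (\<Sum>k=3..n. (int k - 1) * int (gamma k))"
  using assms
proof (induction n rule: dec_induct)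
  case base
  show ?case by (simp add: num_partitions_2 nu_2)
next
  case (step n)
  then show ?case
    \<comment> \<open>Substituting \<nu>(n) = \<nu>(n+1) - \<gamma>(n+1) turns n \<nu>(n) +
      \<nu>(n+1) into (n+1) \<nu>(n+1) - n \<gamma>(n+1), whose last term is the new summand k =
      n+1.\<close>
    by (simp add: num_partitions_Suc nu_Suc algebra_simps)
qed

end
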